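(* Let $G$ be a connected recurrent graph, let $X$ and $Y$ be independent simple random walks on $G$, and let $Z=\sum_{t=0}^{\infty}\mathbf{1}(X_t=Y_t)$ be the number of collisions. Then for each $(a,b)\in G\times G$, $$P_{a,b}(Z=\infty)\in\{0,1\}.$$ Further, if there exist $a_0,b_0$ such that $P_{a_0,b_0}(Z=\infty)>0$, then $P_{a,b}(Z=\infty)=1$ for all $a,b$ such that $P_{a,b}(X_m=a_0,\,Y_m=b_0)>0$ for some $m\ge 0$. In particular, either $P_{a,a}(Z=\infty)=0$ for all vertices $a$, or else $P_{a,a}(Z=\infty)=1$ for all vertices $a$.
   Context: Random walks are discrete-time simple random walks; $G$ is recurrent if simple random walk on $G$ is recurrent. $P_{a,b}$ denotes the law of $((X_t,Y_t))_{t\in\mathbb{Z}_+}$ when $X_0=a$, $Y_0=b$. *)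

theory Defs
  imports "HOL-Probability.Probability"
begin

definition simple_graph :: "'a set \<Rightarrow> 'a set set \<Rightarrow> bool" where
  "simple_graph V E \<longleftrightarrow> E \<subseteq> {{x, y} |x y. x \<in> V \<and> y \<in> V \<and> x \<noteq> y}"

definition nbrs :: "'a set set \<Rightarrow> 'a \<Rightarrow> 'a set" where
  "nbrs E x = {y. {x, y} \<in> E}"

definition locally_finite :: "'a set \<Rightarrow> 'a set set \<Rightarrow> bool" where
  "locally_finite V E \<longleftrightarrow> (\<forall>x\<in>V. finite (nbrs E x))"

definition connected_graph :: "'a set \<Rightarrow> 'a set set \<Rightarrow> bool" where
  "connected_graph V E \<longleftrightarrow> (\<forall>x\<in>V. \<forall>y\<in>V. (\<lambda>u v. {u, v} \<in> E)\<^sup>*\<^sup>* x y)"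

text \<open>Transition probabilities of simple random walk. By convention the walk stays put at a vertex
  without neighbours; in a connected graph such a vertex is the only one.\<close>

definition srw_trans :: "'a set set \<Rightarrow> 'a \<Rightarrow> 'a \<Rightarrow> real" where
  "srw_trans E x y =
     (if nbrs E x = {} then of_bool (y = x) else of_bool (y \<in> nbrs E x) / real (card (nbrs E x)))"

definition srw_kernel :: "'a set \<Rightarrow> 'a set set \<Rightarrow> 'a \<Rightarrow> nat \<Rightarrow> (nat \<Rightarrow> 'a) \<Rightarrow> 'a measure" where
  "srw_kernel V E a t \<omega> =
     (case t of 0 \<Rightarrow> return (count_space V) a
      | Suc s \<Rightarrow> point_measure V (\<lambda>y. ennreal (srw_trans E (\<omega> s) y)))"

text \<open>The law on trajectories of simple random walk started at \<^term>\<open>a\<close>, given by the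
  Ionescu-Tulcea construction; see \<open>srw_law_path\<close> below for its finite-dimensional distributions.
  The state space carries the discrete sigma-algebra on \<^term>\<open>V\<close>, which is countable whenever the
  graph is connected and locally finite, so that the collision event is measurable for the
  product law.\<close>

definition srw_law :: "'a set \<Rightarrow> 'a set set \<Rightarrow> 'a \<Rightarrow> (nat \<Rightarrow> 'a) measure" where
  "srw_law V E a =
     projective_family.lim UNIV
       (Ionescu_Tulcea.CI (srw_kernel V E a) (\<lambda>_. count_space V)) (\<lambda>_. count_space V)"

definition recurrent_graph :: "'a set \<Rightarrow> 'a set set \<Rightarrow> bool" where
  "recurrent_graph V E \<longleftrightarrow> (\<forall>x\<in>V. \<P>(\<omega> in srw_law V E x. \<exists>t\<ge>1. \<omega> t = x) = 1)"

definition indep_walks :: "'a set \<Rightarrow> 'a set set \<Rightarrow> 'a \<Rightarrow> 'a \<Rightarrow> ((nat \<Rightarrow> 'a) \<times> (nat \<Rightarrow> 'a)) measure" where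
  "indep_walks V E a b = srw_law V E a \<Otimes>\<^sub>M srw_law V E b"

definition num_collisions :: "(nat \<Rightarrow> 'a) \<times> (nat \<Rightarrow> 'a) \<Rightarrow> ennreal" where
  "num_collisions = (\<lambda>(X, Y). \<Sum>t. of_bool (X t = Y t))"

lemma srw_trans_nonneg: "0 \<le> srw_trans E x y"
  by (simp add: srw_trans_def)

lemma prob_space_srw_step:
  assumes G: "simple_graph V E" "locally_finite V E" and x: "x \<in> V"
  shows "prob_space (point_measure V (\<lambda>y. ennreal (srw_trans E x y)))"
proof
  define N where "N = (if nbrs E x = {} then {x} else nbrs E x)"
  have nV: "nbrs E x \<subseteq> V"
    using G(1) by (fastforce simp: simple_graph_def nbrs_def doubleton_eq_iff)
  have fin: "finite (nbrs E x)"
    using G(2) x by (simp add: locally_finite_def)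
  have N: "finite N" "N \<subseteq> V"
    using nV fin x by (auto simp: N_def)
  have supp: "{y \<in> V. 0 < ennreal (srw_trans E x y)} = N"
    using nV fin x by (auto simp: N_def srw_trans_def card_gt_0_iff)
  have "emeasure (point_measure V (\<lambda>y. ennreal (srw_trans E x y))) V
      = (\<Sum>y\<in>N. ennreal (srw_trans E x y))"
    using N by (subst emeasure_point_measure) (simp_all only: supp)
  also have "\<dots> = ennreal (\<Sum>y\<in>N. srw_trans E x y)"
    by (simp add: srw_trans_nonneg)
  also have "(\<Sum>y\<in>N. srw_trans E x y) = 1"
    using fin by (auto simp: N_def srw_trans_def)
  finally show "emeasure (point_measure V (\<lambda>y. ennreal (srw_trans E x y)))
      (space (point_measure V (\<lambda>y. ennreal (srw_trans E x y)))) = 1"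
    by (simp add: space_point_measure)
qed

lemma Ionescu_Tulcea_srw_kernel:
  fixes V :: "'a set"
  assumes G: "simple_graph V E" "locally_finite V E" and a: "a \<in> V"
  shows "Ionescu_Tulcea (srw_kernel V E a) (\<lambda>_. count_space V)"
proof (rule Ionescu_Tulcea.intro)
  fix i
  show "srw_kernel V E a i \<in> (\<Pi>\<^sub>M i\<in>{0..<i}. count_space V) \<rightarrow>\<^sub>M subprob_algebra (count_space V)"
  proof (cases i)
    case 0
    have "return (count_space V) a \<in> space (subprob_algebra (count_space V))"
      using a by (auto simp: space_subprob_algebra intro!: prob_space_imp_subprob_space prob_space_return)
    with 0 show ?thesis
      by (simp add: srw_kernel_def[abs_def])
  next
    case (Suc s)
    let ?f = "\<lambda>x. point_measure V (\<lambda>y. ennreal (srw_trans E x y))"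
    have f: "?f \<in> count_space V \<rightarrow>\<^sub>M subprob_algebra (count_space V)"
      using prob_space_srw_step[OF G]
      by (auto simp: space_subprob_algebra sets_point_measure intro!: prob_space_imp_subprob_space)
    have "(\<lambda>\<omega>. \<omega> s) \<in> (\<Pi>\<^sub>M i\<in>{0..<Suc s}. count_space V) \<rightarrow>\<^sub>M count_space V"
      by (rule measurable_component_singleton) simp
    from measurable_compose[OF this f] show ?thesis
      unfolding Suc srw_kernel_def nat.case .
  qed
next
  fix i :: nat and x
  assume "x \<in> space (\<Pi>\<^sub>M i\<in>{0..<i}. count_space V)"
  then show "prob_space (srw_kernel V E a i x)"
    using a by (cases i)
      (auto simp: srw_kernel_def space_PiM PiE_iff intro!: prob_space_return prob_space_srw_step[OF G])
qed

lemma sets_srw_law: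
  assumes "simple_graph V E" "locally_finite V E" "a \<in> V"
  shows "sets (srw_law V E a) = sets (\<Pi>\<^sub>M t\<in>UNIV. count_space V)"
proof -
  interpret Ionescu_Tulcea "srw_kernel V E a" "\<lambda>_. count_space V"
    by (rule Ionescu_Tulcea_srw_kernel) fact+
  show ?thesis by (simp add: srw_law_def)
qed

lemma prob_space_srw_law:
  assumes "simple_graph V E" "locally_finite V E" "a \<in> V"
  shows "prob_space (srw_law V E a)"
proof -
  interpret Ionescu_Tulcea "srw_kernel V E a" "\<lambda>_. count_space V"
    by (rule Ionescu_Tulcea_srw_kernel) fact+
  have "prob_space (distr PF.lim (PiM {} (\<lambda>_. count_space V)) (\<lambda>x. restrict x {}))"
    unfolding distr_lim[OF finite.emptyI] by (rule PF.prob_space_P) auto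
  then show ?thesis
    unfolding srw_law_def by (rule prob_space_distrD[rotated]) (auto simp: measurable_cong_sets[OF PF.sets_lim refl] intro!: measurable_restrict)
qed

lemma srw_law_path:
  assumes G: "simple_graph V E" "locally_finite V E" and a: "a \<in> V"
    and x: "\<And>i. i \<le> n \<Longrightarrow> x i \<in> V"
  shows "\<P>(\<omega> in srw_law V E a. \<forall>i\<le>n. \<omega> i = x i)
    = of_bool (x 0 = a) * (\<Prod>i<n. srw_trans E (x i) (x (Suc i)))"
proof -
  interpret Ionescu_Tulcea "srw_kernel V E a" "\<lambda>_. count_space V"
    by (rule Ionescu_Tulcea_srw_kernel) fact+
  let ?M = "\<lambda>_::nat. count_space V"
  let ?u = "\<lambda>_::nat. undefined :: 'a"
  define p where "p n = of_bool (x 0 = a) * (\<Prod>i<n. srw_trans E (x i) (x (Suc i)))" for n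
  have p0: "0 \<le> p m" for m by (simp add: p_def prod_nonneg srw_trans_nonneg)
  define S where "S m = (PiE {0..<m} (\<lambda>i. {x i}))" for m
  have S: "S m \<in> sets (PiM {0..<m} ?M)" if "m \<le> Suc n" for m
    using that x unfolding S_def by (intro sets_PiM_I_finite) auto
  have u: "?u \<in> space (PiM {0..<0} ?M)" by (auto simp: space_PiM PiE_iff extensional_def)
  have S_upd: "fun_upd \<omega> m y \<in> S (Suc m) \<longleftrightarrow> y = x m \<and> \<omega> \<in> S m"
    if "\<omega> \<in> space (PiM {0..<m} ?M)" for \<omega> m y
  proof -
    have "\<omega> i = undefined" if "i \<ge> m" for i
      using \<open>\<omega> \<in> space _\<close> that by (auto simp: space_PiM PiE_def extensional_def)
    then show ?thesis
      unfolding S_def PiE_def Pi_def extensional_def by (auto simp: less_Suc_eq)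
  qed
  have main: "emeasure (C 0 (Suc m) ?u) (S (Suc m)) = ennreal (p m)" if "m \<le> n" for m
    using that
  proof (induction m)
    case 0
    have "C 0 (Suc 0) ?u = eP 0 ?u"
      unfolding C.simps add_0_right by (rule bind_return[OF measurable_eP u])
    then have "emeasure (C 0 (Suc 0) ?u) (S (Suc 0)) = emeasure (eP 0 ?u) (S (Suc 0))"
      by (rule arg_cong)
    also have "\<dots> = emeasure (return (count_space V) a) ((\<lambda>y. fun_upd ?u 0 y) -` S (Suc 0) \<inter> V)"
      using emeasure_eP[OF u S] by (simp add: srw_kernel_def)
    also have "(\<lambda>y. fun_upd ?u 0 y) -` S (Suc 0) \<inter> V = {x 0}"
      using x[of 0] S_upd[OF u] u by (auto simp: S_def space_PiM)
    finally show ?case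
      using x[of 0] by (auto simp: p_def emeasure_return indicator_def)
  next
    case (Suc m)
    define D where "D = C 0 (Suc m) ?u"
    have sD: "sets D = sets (PiM {0..<Suc m} ?M)"
      using sets_C[OF u, of "Suc m"] by (simp only: D_def add_0)
    have neD: "space D \<noteq> {}"
      unfolding D_def by (rule prob_space.not_empty[OF prob_space_C[OF u]])
    have mD: "eP (Suc m) \<in> D \<rightarrow>\<^sub>M subprob_algebra (PiM {0..<Suc (Suc m)} ?M)"
      unfolding measurable_cong_sets[OF sD refl] by (rule measurable_eP)
    have "emeasure (C 0 (Suc (Suc m)) ?u) (S (Suc (Suc m)))
      = (\<integral>\<^sup>+\<omega>. emeasure (eP (Suc m) \<omega>) (S (Suc (Suc m))) \<partial>D)"
      unfolding C.simps(2)[of 0 "Suc m"] add_0 D_def[symmetric]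
      using Suc.prems by (intro emeasure_bind[OF neD mD] S) simp
    also have "\<dots> = (\<integral>\<^sup>+\<omega>. ennreal (srw_trans E (x m) (x (Suc m))) * indicator (S (Suc m)) \<omega> \<partial>D)"
    proof (rule nn_integral_cong)
      fix \<omega> assume "\<omega> \<in> space D"
      then have \<omega>: "\<omega> \<in> space (PiM {0..<Suc m} ?M)" using sets_eq_imp_space_eq[OF sD] by simp
      have "emeasure (eP (Suc m) \<omega>) (S (Suc (Suc m)))
        = emeasure (point_measure V (\<lambda>y. ennreal (srw_trans E (\<omega> m) y)))
            ((\<lambda>y. fun_upd \<omega> (Suc m) y) -` S (Suc (Suc m)) \<inter> V)"
        using emeasure_eP[OF \<omega> S] Suc.prems by (simp add: srw_kernel_def)
      also have "(\<lambda>y. fun_upd \<omega> (Suc m) y) -` S (Suc (Suc m)) \<inter> V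
          = (if \<omega> \<in> S (Suc m) then {x (Suc m)} else {})"
        using x[of "Suc m"] Suc.prems S_upd[OF \<omega>] by auto
      finally show "emeasure (eP (Suc m) \<omega>) (S (Suc (Suc m)))
        = ennreal (srw_trans E (x m) (x (Suc m))) * indicator (S (Suc m)) \<omega>"
        using x[of "Suc m"] Suc.prems
        by (auto simp: emeasure_point_measure_finite2 S_def PiE_iff split: split_indicator)
    qed
    also have "\<dots> = ennreal (srw_trans E (x m) (x (Suc m))) * ennreal (p m)"
      using Suc.IH[folded D_def] Suc.prems S[of "Suc m"]
      by (subst nn_integral_cmult_indicator) (simp_all add: sD)
    also have "\<dots> = ennreal (p (Suc m))"
      by (simp add: p_def ennreal_mult'[symmetric] srw_trans_nonneg mult_ac)
    finally show ?case .
  qed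
  have "{\<omega> \<in> space (srw_law V E a). \<forall>i\<le>n. \<omega> i = x i} = PF.emb UNIV {0..<Suc n} (S (Suc n))"
    unfolding srw_law_def S_def by (auto simp: prod_emb_def space_PiM PiE_iff less_Suc_eq_le)
  then have "emeasure (srw_law V E a) {\<omega> \<in> space (srw_law V E a). \<forall>i\<le>n. \<omega> i = x i}
      = emeasure (CI {0..<Suc n}) (S (Suc n))"
    unfolding srw_law_def by (simp only: lim[OF _ S] finite_atLeastLessThan order_refl)
  also have "\<dots> = emeasure (C 0 (Suc n) ?u) (S (Suc n))"
    using emeasure_CI[of "{0..<Suc n}" "Suc n" "S (Suc n)"] S[of "Suc n"]
    by (simp add: prod_emb_id[OF sets.sets_into_space[OF S[of "Suc n"], unfolded space_PiM]])
  also have "\<dots> = ennreal (p n)" by (rule main) simp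
  finally show ?thesis
    by (simp add: measure_def p_def[symmetric] p0)
qed

end

theory Submission
  imports Defs
begin

text \<open>
  Fix the trajectory \<open>y\<close> of the second walk. Let \<open>g m\<close> be the probability that the first walk, started
  at \<open>a\<close>, infinitely often agrees with \<open>t \<mapsto> y (t + m)\<close>. Stopping at the first visit to \<open>a\<close> from
  time \<open>j\<close> on, which recurrence makes finite, shows that \<open>g m\<close> is a weighted mean of the values
  \<open>g (m + k)\<close>; a bounded function with this property is invariant under every shift that has positive
  weight, by a Choquet-Deny argument. Hence \<open>g k = g 0\<close> for every possible return time \<open>k\<close>, so the event
  of infinitely many collisions with \<open>y\<close> is independent of every finite initial segment of the walk,
  hence of itself, and has probability 0 or 1.

  By Fubini the collision event is then, up to null sets, contained in a rectangle whose sides both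
  have its own probability \<open>p\<close>. So \<open>p \<le> p\<^sup>2\<close>, that is, \<open>p\<close> is 0 or 1. The remaining claims follow from
  the Markov property at a fixed time and, on the diagonal, from the fact that two walks started at the
  same vertex can follow the same path.
\<close>

subsection \<open>Bounded harmonic functions of a renewal walk\<close>

text \<open>Since the weights sum to 1, \<open>s - d\<close> is the series of the nonnegative terms
  \<open>p k * (s - D k)\<close>, and a single term is at most the whole. So a mean close to the
  bound \<open>s\<close> forces every value of positive weight to be close to
  \<open>s\<close>.\<close>

lemma weighted_mean_gap:
  fixes p D :: "nat \<Rightarrow> real"
  assumes p: "p sums 1" "\<And>k. 0 \<le> p k"
    and harm: "(\<lambda>k. p k * D k) sums d" and s: "\<And>k. D k \<le> s"
  shows "p j * (s - D j) \<le> s - d"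
proof -
  have 1: "(\<lambda>k. p k * (s - D k)) sums (s - d)"
    using sums_diff[OF sums_mult2[OF p(1), of s] harm] by (simp add: algebra_simps)
  have "sum (\<lambda>k. p k * (s - D k)) {j} \<le> suminf (\<lambda>k. p k * (s - D k))"
    using p(2) s by (intro sum_le_suminf) (auto intro: sums_summable[OF 1])
  then show ?thesis using sums_unique[OF 1] by simp
qed

text \<open>The increments of a harmonic function are harmonic and bounded as well. If their
  supremum were positive, they would be nearly maximal along a long arithmetic progression,
  contradicting the boundedness of \<open>g\<close>.\<close>

lemma bounded_harmonic_increment_le_0:
  fixes p g :: "nat \<Rightarrow> real"
  assumes p: "p sums 1" "\<And>k. 0 \<le> p k" and j: "0 < p j"
    and harm: "\<And>n. (\<lambda>k. p k * g (n + k)) sums g n" and g: "\<And>n. \<bar>g n\<bar> \<le> c"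
  shows "g (n + j) \<le> g n"
proof (rule ccontr)
  assume neg: "\<not> ?thesis"
  define D where "D n = g (n + j) - g n" for n
  define s where "s = (SUP n. D n)"
  have bdd: "bdd_above (range D)"
  proof (rule bdd_aboveI2)
    show "D n \<le> 2 * c" for n using g[of n] g[of "n + j"] unfolding D_def by linarith
  qed
  have Ds: "D n \<le> s" for n unfolding s_def by (rule cSUP_upper[OF _ bdd]) simp
  have s0: "0 < s" using neg Ds[of n] unfolding D_def by linarith
  have harmD: "(\<lambda>k. p k * D (n + k)) sums D n" for n
    using sums_diff[OF harm[of "n + j"] harm[of n]]
    by (simp add: D_def algebra_simps)
  have gap: "p j * (s - D (n + j)) \<le> s - D n" for n
    using weighted_mean_gap[OF p harmD[of n] Ds] by simp
  \<comment> \<open>Where \<open>D\<close> is nearly maximal it stays so along \<open>M\<close> steps of size \<open>j\<close>; these increments of \<open>g\<close> add up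
    to more than the oscillation of \<open>g\<close>.\<close>
  obtain M :: nat where M: "2 * c < M * (s / 2)"
    using reals_Archimedean3[of "s / 2"] s0 by (metis half_gt_zero)
  \<comment> \<open>Each step of size \<open>j\<close> can enlarge the gap to \<open>s\<close> by a
    factor \<open>1 / p j\<close>. Starting with a gap below \<open>e\<close> keeps it at most
    \<open>s / 2\<close> for all steps before the \<open>M\<close>-th.\<close>
  define e where "e = s / 2 * p j ^ M"
  have e: "0 < e" using s0 j by (simp add: e_def)
  have "\<exists>n. s - e < D n"
    using less_cSUP_iff[of UNIV D "s - e"] bdd e by (auto simp: s_def)
  then obtain n where n: "s - e < D n" ..
  have pj1: "p j \<le> 1"
    using sum_le_suminf[OF sums_summable[OF p(1)], of "{j}"] p(2) sums_unique[OF p(1)] by simp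
  have near: "p j ^ i * (s - D (n + i * j)) \<le> e" for i
  proof (induction i)
    case 0 show ?case using n by simp
  next
    case (Suc i)
    have "p j ^ Suc i * (s - D (n + Suc i * j)) = p j ^ i * (p j * (s - D (n + i * j + j)))"
      by (simp add: algebra_simps)
    also have "\<dots> \<le> p j ^ i * (s - D (n + i * j))"
      using gap[of "n + i * j"] j by (intro mult_left_mono) auto
    finally show ?case using Suc by linarith
  qed
  have half: "s / 2 \<le> D (n + i * j)" if "i < M" for i
  proof -
    have "p j ^ i * (s - D (n + i * j)) \<le> s / 2 * p j ^ M" using near[of i] by (simp add: e_def)
    also have "\<dots> \<le> s / 2 * p j ^ i"
      using that j pj1 s0 by (intro mult_left_mono power_decreasing) auto
    finally have "p j ^ i * (s - D (n + i * j)) \<le> p j ^ i * (s / 2)" by (simp add: mult.commute)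
    then show ?thesis using j by (simp add: field_simps)
  qed
  have tel: "(\<Sum>i<m. D (n + i * j)) = g (n + m * j) - g n" for m
    by (induction m) (simp_all add: D_def algebra_simps)
  have "M * (s / 2) \<le> (\<Sum>i<M. D (n + i * j))"
    using sum_mono[of "{..<M}" "\<lambda>_. s / 2"] half by simp
  also have "\<dots> \<le> 2 * c"
    unfolding tel using g[of n] g[of "n + M * j"] by linarith
  finally show False using M by simp
qed

text \<open>The one-sided bound applies to both \<open>g\<close> and \<open>- g\<close>.\<close>

lemma bounded_harmonic_periodic:
  fixes p g :: "nat \<Rightarrow> real"
  assumes p: "p sums 1" "\<And>k. 0 \<le> p k" "0 < p j"
    and harm: "\<And>n. (\<lambda>k. p k * g (n + k)) sums g n" and g: "\<And>n. \<bar>g n\<bar> \<le> c"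
  shows "g (n + j) = g n"
proof (rule antisym)
  show "g (n + j) \<le> g n" by (rule bounded_harmonic_increment_le_0) fact+
  have "- g (n + j) \<le> - g n"
    using sums_minus[OF harm] g
    by (intro bounded_harmonic_increment_le_0[OF p, of "\<lambda>n. - g n" c]) simp_all
  then show "g n \<le> g (n + j)" by simp
qed

text \<open>Rewrites \<open>Z = \<infinity>\<close> in a form that ignores finitely many times, so
  that shifts become harmless.\<close>

lemma suminf_of_bool_eq_top_iff:
  "(\<Sum>t. of_bool (P t) :: ennreal) = \<infinity> \<longleftrightarrow> (\<exists>\<^sub>F t in sequentially. P t)"
proof
  assume inf: "(\<Sum>t. of_bool (P t) :: ennreal) = \<infinity>"
  show "\<exists>\<^sub>F t in sequentially. P t"
  proof (rule ccontr)
    assume "\<not> ?thesis"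
    then obtain N where "\<And>t. N \<le> t \<Longrightarrow> \<not> P t"
      by (auto simp: frequently_def eventually_sequentially)
    then have "(\<Sum>t. of_bool (P t) :: ennreal) = (\<Sum>t<N. of_bool (P t))"
      by (intro suminf_finite) auto
    also have "\<dots> \<noteq> \<infinity>" by (auto simp: of_bool_def)
    finally show False using inf by simp
  qed
next
  assume freq: "\<exists>\<^sub>F t in sequentially. P t"
  show "(\<Sum>t. of_bool (P t) :: ennreal) = \<infinity>"
  proof (rule ccontr)
    assume "\<not> ?thesis"
    moreover have "(of_bool (P t) :: ennreal) = ennreal (of_bool (P t))" for t by simp
    ultimately have "summable (\<lambda>t. of_bool (P t) :: real)"
      by (intro summable_suminf_not_top) auto
    then have "(\<lambda>t. of_bool (P t) :: real) \<longlonglongrightarrow> 0" by (rule summable_LIMSEQ_zero)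
    then have "\<forall>\<^sub>F t in sequentially. of_bool (P t) < (1::real)" by (rule order_tendstoD) simp
    then have "\<forall>\<^sub>F t in sequentially. \<not> P t" by eventually_elim auto
    with freq show False by (simp add: frequently_def)
  qed
qed

subsection \<open>Trajectories and path cylinders\<close>

definition time_shift :: "nat \<Rightarrow> (nat \<Rightarrow> 'a) \<Rightarrow> nat \<Rightarrow> 'a" where
  "time_shift n \<omega> = (\<lambda>t. \<omega> (t + n))"

abbreviation trajectories :: "'a set \<Rightarrow> (nat \<Rightarrow> 'a) measure" where
  "trajectories V \<equiv> \<Pi>\<^sub>M t\<in>UNIV. count_space V"

text \<open>Only the values of \<open>x\<close> up to \<open>n\<close> matter, so finite paths need
  no type of their own.\<close>

definition cyl :: "'a set \<Rightarrow> nat \<Rightarrow> (nat \<Rightarrow> 'a) \<Rightarrow> (nat \<Rightarrow> 'a) set" where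
  "cyl V n x = {\<omega> \<in> space (trajectories V). \<forall>i\<le>n. \<omega> i = x i}"

text \<open>A set-theoretic substitute for membership in the sigma-algebra of the walk up to time
  \<open>n\<close>; for countable \<open>V\<close> such sets are countable unions of
  cylinders.\<close>

definition determined_upto :: "'a set \<Rightarrow> nat \<Rightarrow> (nat \<Rightarrow> 'a) set \<Rightarrow> bool" where
  "determined_upto V n B \<longleftrightarrow> (\<forall>\<omega>\<in>space (trajectories V). \<forall>\<omega>'\<in>space (trajectories V).
     (\<forall>i\<le>n. \<omega> i = \<omega>' i) \<longrightarrow> (\<omega> \<in> B \<longleftrightarrow> \<omega>' \<in> B))"

lemma space_trajectories: "\<omega> \<in> space (trajectories V) \<longleftrightarrow> (\<forall>t. \<omega> t \<in> V)"
  by (auto simp: space_PiM PiE_iff)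

lemma measurable_coord [measurable]: "(\<lambda>\<omega>. \<omega> t) \<in> trajectories V \<rightarrow>\<^sub>M count_space V"
  by (rule measurable_component_singleton) simp

lemma measurable_time_shift [measurable]: "time_shift n \<in> trajectories V \<rightarrow>\<^sub>M trajectories V"
  unfolding time_shift_def[abs_def]
  by (rule measurable_PiM_single') (auto simp: space_PiM PiE_iff)

lemma sets_coord_eq [measurable]: "{\<omega> \<in> space (trajectories V). \<omega> t = v} \<in> sets (trajectories V)"
proof -
  have "(\<lambda>\<omega>. \<omega> t) -` ({v} \<inter> V) \<inter> space (trajectories V) \<in> sets (trajectories V)"
    by (rule measurable_sets[OF measurable_coord]) auto
  also have "(\<lambda>\<omega>. \<omega> t) -` ({v} \<inter> V) \<inter> space (trajectories V) = {\<omega> \<in> space (trajectories V). \<omega> t = v}"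
    by (auto simp: space_trajectories)
  finally show ?thesis .
qed

lemma sets_cyl [measurable]: "cyl V n x \<in> sets (trajectories V)"
  unfolding cyl_def by measurable

text \<open>For countable \<open>V\<close> there are countably many initial segments, and their
  cylinders partition the space. Extensional functions list each segment exactly once.\<close>

lemma emeasure_split_cyl:
  assumes V: "countable V" and M: "sets M = sets (trajectories V)" and B: "B \<in> sets M"
  shows "emeasure M B = (\<integral>\<^sup>+x. emeasure M (B \<inter> cyl V n x) \<partial>count_space ({..n} \<rightarrow>\<^sub>E V))"
proof -
  have "B \<subseteq> space (trajectories V)"
    using sets.sets_into_space[OF B] sets_eq_imp_space_eq[OF M] by simp
  then have "B = (\<Union>x\<in>{..n} \<rightarrow>\<^sub>E V. B \<inter> cyl V n x)"
  proof (intro equalityI subsetI)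
    fix \<omega> assume "\<omega> \<in> B" "B \<subseteq> space (trajectories V)"
    then have "restrict \<omega> {..n} \<in> {..n} \<rightarrow>\<^sub>E V" "\<omega> \<in> B \<inter> cyl V n (restrict \<omega> {..n})"
      by (auto simp: cyl_def space_trajectories subset_iff)
    then show "\<omega> \<in> (\<Union>x\<in>{..n} \<rightarrow>\<^sub>E V. B \<inter> cyl V n x)" by blast
  qed auto
  also have "emeasure M \<dots> = (\<integral>\<^sup>+x. emeasure M (B \<inter> cyl V n x) \<partial>count_space ({..n} \<rightarrow>\<^sub>E V))"
  proof (rule emeasure_UN_countable)
    show "countable ({..n} \<rightarrow>\<^sub>E V)" using V by (intro countable_PiE) auto
    show "disjoint_family_on (\<lambda>x. B \<inter> cyl V n x) ({..n} \<rightarrow>\<^sub>E V)"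
      unfolding disjoint_family_on_def
    proof (intro ballI impI)
      fix x y assume "x \<in> {..n} \<rightarrow>\<^sub>E V" "y \<in> {..n} \<rightarrow>\<^sub>E V" "x \<noteq> y"
      then obtain i where "i \<le> n" "x i \<noteq> y i" by (metis PiE_ext atMost_iff)
      then show "B \<inter> cyl V n x \<inter> (B \<inter> cyl V n y) = {}" by (auto simp: cyl_def)
    qed
  qed (use B M in auto)
  finally show ?thesis .
qed

lemma determined_cyl:
  assumes "determined_upto V n B"
  shows "B \<inter> cyl V n x = {} \<or> B \<inter> cyl V n x = cyl V n x"
  using assms unfolding determined_upto_def cyl_def by fastforce

text \<open>Finite-dimensional boxes determine a finite measure, and a box over coordinates up to
  \<open>n\<close> is a countable disjoint union of cylinders of length \<open>n\<close>.\<close>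

lemma measure_eqI_cyl:
  assumes V: "countable V" and M: "sets M = sets (trajectories V)" "finite_measure M"
    and N: "sets N = sets (trajectories V)"
    and eq: "\<And>n x. (\<And>i. i \<le> n \<Longrightarrow> x i \<in> V) \<Longrightarrow> emeasure M (cyl V n x) = emeasure N (cyl V n x)"
  shows "M = N"
proof (rule measure_eqI_PiM_infinite[OF M(1) N _ M(2)])
  fix J :: "nat set" and A assume J: "finite J" and A: "\<And>i. i \<in> J \<Longrightarrow> A i \<in> sets (count_space V)"
  let ?B = "prod_emb UNIV (\<lambda>_. count_space V) J (Pi\<^sub>E J A)"
  obtain n where n: "J \<subseteq> {..n}" using J finite_nat_set_iff_bounded_le by auto
  have B: "?B \<in> sets (trajectories V)" using J A by (intro sets_PiM_I) auto
  have det: "determined_upto V n ?B"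
    using n unfolding determined_upto_def prod_emb_def
    by (auto simp: space_PiM PiE_iff subset_iff)
  have "emeasure M (?B \<inter> cyl V n x) = emeasure N (?B \<inter> cyl V n x)" if "x \<in> {..n} \<rightarrow>\<^sub>E V" for x
    using determined_cyl[OF det, of x] eq[of n x] that by (auto simp: PiE_iff)
  then show "emeasure M ?B = emeasure N ?B"
    using B M(1) N emeasure_split_cyl[OF V M(1), of ?B n] emeasure_split_cyl[OF V N, of ?B n]
    by (auto intro!: nn_integral_cong)
qed

subsection \<open>The Markov property\<close>

text \<open>By local finiteness finitely many vertices are reached in \<open>n\<close> steps from a
  fixed vertex; by connectedness these sets cover \<open>V\<close>.\<close>

lemma countable_connected_graph:
  assumes "simple_graph V E" "locally_finite V E" "connected_graph V E"
  shows "countable V"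
proof (cases "V = {}")
  case False
  then obtain a where a: "a \<in> V" by blast
  let ?R = "\<lambda>u v. {u, v} \<in> E"
  have nbrs_V: "y \<in> V" if "{x, y} \<in> E" for x y
    using that assms(1) by (fastforce simp: simple_graph_def doubleton_eq_iff)
  have ball: "finite {y. (?R ^^ n) a y} \<and> {y. (?R ^^ n) a y} \<subseteq> V" for n
  proof (induction n)
    case 0 show ?case using a by simp
  next
    case (Suc n)
    have "{y. (?R ^^ Suc n) a y} = (\<Union>x\<in>{x. (?R ^^ n) a x}. nbrs E x)"
      by (auto simp: nbrs_def)
    then show ?case
      using Suc assms(2) nbrs_V by (auto simp: locally_finite_def nbrs_def)
  qed
  have "V \<subseteq> (\<Union>n. {y. (?R ^^ n) a y})"
    using assms(3) a by (auto simp: connected_graph_def rtranclp_is_Sup_relpowp)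
  moreover have "countable (\<Union>n. {y. (?R ^^ n) a y})"
    using ball by (intro countable_UN) (auto intro: countable_finite)
  ultimately show ?thesis by (rule countable_subset)
qed simp

lemma prod_lessThan_add:
  fixes f :: "nat \<Rightarrow> 'b::comm_monoid_mult"
  shows "(\<Prod>i<n + m. f i) = (\<Prod>i<n. f i) * (\<Prod>i<m. f (n + i))"
  by (induction m) (simp_all add: mult.assoc)

locale srw_graph =
  fixes V :: "'a set" and E :: "'a set set"
  assumes simple: "simple_graph V E" and locally_finite: "locally_finite V E"
    and connected: "connected_graph V E"
begin

abbreviation W :: "'a \<Rightarrow> (nat \<Rightarrow> 'a) measure" where
  "W a \<equiv> srw_law V E a"

abbreviation \<Omega> :: "(nat \<Rightarrow> 'a) set" where
  "\<Omega> \<equiv> space (trajectories V)"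

lemma countable_V: "countable V"
  using countable_connected_graph simple locally_finite connected .

lemma sets_W: "a \<in> V \<Longrightarrow> sets (W a) = sets (trajectories V)"
  by (rule sets_srw_law[OF simple locally_finite])

lemma space_W: "a \<in> V \<Longrightarrow> space (W a) = \<Omega>"
  by (rule sets_eq_imp_space_eq[OF sets_W])

lemma prob_space_W: "a \<in> V \<Longrightarrow> prob_space (W a)"
  by (rule prob_space_srw_law[OF simple locally_finite])

lemma finite_measure_W: "a \<in> V \<Longrightarrow> finite_measure (W a)"
  using prob_space_W by (blast intro: prob_space.finite_measure)

lemma measure_W_\<Omega>: "a \<in> V \<Longrightarrow> measure (W a) \<Omega> = 1"
  using prob_space.prob_space[OF prob_space_W] space_W by simp

lemma measure_cyl:
  assumes "a \<in> V" "\<And>i. i \<le> n \<Longrightarrow> x i \<in> V"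
  shows "measure (W a) (cyl V n x) = of_bool (x 0 = a) * (\<Prod>i<n. srw_trans E (x i) (x (Suc i)))"
  using srw_law_path[OF simple locally_finite assms] space_W[OF assms(1)] by (simp add: cyl_def)

text \<open>If \<open>z\<close> starts where \<open>x\<close> ends, the event is the cylinder of the
  concatenated path, and the product of transition probabilities splits at time \<open>n\<close>.
  Otherwise both sides vanish.\<close>

lemma markov_cyl_cyl:
  assumes a: "a \<in> V" and x: "\<And>i. i \<le> n \<Longrightarrow> x i \<in> V" and z: "\<And>i. i \<le> m \<Longrightarrow> z i \<in> V"
  shows "measure (W a) (cyl V n x \<inter> time_shift n -` cyl V m z)
    = measure (W a) (cyl V n x) * measure (W (x n)) (cyl V m z)"
proof (cases "z 0 = x n")
  case False
  then have "cyl V n x \<inter> time_shift n -` cyl V m z = {}" by (fastforce simp: cyl_def time_shift_def)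
  moreover have "measure (W (x n)) (cyl V m z) = 0" using False x z by (subst measure_cyl) auto
  ultimately show ?thesis by simp
next
  case True
  \<comment> \<open>The concatenated path; at the joint \<open>i = n\<close> both pieces give the
    same vertex because \<open>z 0 = x n\<close>.\<close>
  define w where "w i = (if i < n then x i else z (i - n))" for i
  have w_le: "w i = x i" if "i \<le> n" for i using that True by (cases "i = n") (auto simp: w_def)
  have w_add: "w (n + i) = z i" for i by (simp add: w_def)
  have wV: "w i \<in> V" if "i \<le> n + m" for i using that x z by (auto simp: w_def)
  have "cyl V n x \<inter> time_shift n -` cyl V m z = cyl V (n + m) w"
  proof (intro equalityI subsetI)
    fix \<omega> assume \<omega>: "\<omega> \<in> cyl V n x \<inter> time_shift n -` cyl V m z"
    then have 1: "\<omega> i = w i" if "i \<le> n" for i using that w_le by (auto simp: cyl_def)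
    have "\<omega> (i + n) = w (n + i)" if "i \<le> m" for i
      using \<omega> that by (auto simp: cyl_def time_shift_def w_add)
    then have "\<omega> i = w i" if "n \<le> i" "i \<le> n + m" for i
      using that by (metis add.commute le_Suc_ex nat_add_left_cancel_le)
    with 1 \<omega> show "\<omega> \<in> cyl V (n + m) w" by (auto simp: cyl_def) (metis nle_le)
  next
    fix \<omega> assume \<omega>: "\<omega> \<in> cyl V (n + m) w"
    then have eq: "\<omega> i = w i" if "i \<le> n + m" for i using that by (auto simp: cyl_def)
    show "\<omega> \<in> cyl V n x \<inter> time_shift n -` cyl V m z"
      using \<omega> by (auto simp: cyl_def time_shift_def space_trajectories eq w_le w_add add.commute[of _ n])
  qed
  then have "measure (W a) (cyl V n x \<inter> time_shift n -` cyl V m z)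
      = of_bool (w 0 = a) * (\<Prod>i<n + m. srw_trans E (w i) (w (Suc i)))"
    using measure_cyl[of a "n + m" w] a wV by simp
  also have "(\<Prod>i<n + m. srw_trans E (w i) (w (Suc i)))
     = (\<Prod>i<n. srw_trans E (x i) (x (Suc i))) * (\<Prod>i<m. srw_trans E (z i) (z (Suc i)))"
    unfolding prod_lessThan_add by (simp add: w_le w_add add_Suc_right[symmetric] del: add_Suc_right)
  finally show ?thesis
    using measure_cyl[of a n x] measure_cyl[of "x n" m z] a x z True by (simp add: w_le)
qed

text \<open>As functions of \<open>C\<close> both sides are finite measures, and
  \<open>markov_cyl_cyl\<close> says that they agree on cylinders.\<close>

lemma markov_cyl:
  assumes a: "a \<in> V" and x: "\<And>i. i \<le> n \<Longrightarrow> x i \<in> V" and C: "C \<in> sets (trajectories V)"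
  shows "emeasure (W a) (cyl V n x \<inter> time_shift n -` C)
    = emeasure (W a) (cyl V n x) * emeasure (W (x n)) C"
proof -
  interpret A: finite_measure "W a" using a by (rule finite_measure_W)
  have xn: "x n \<in> V" using x by simp
  interpret X: finite_measure "W (x n)" using xn by (rule finite_measure_W)
  \<comment> \<open>\<open>K\<close> restricts the law to the given initial segment while keeping
    the whole trajectory space; \<open>M\<close> is its image under the shift, the left side as a
    measure in \<open>C\<close>, and \<open>N\<close> is the right side.\<close>
  define K where "K = density (W a) (indicator (cyl V n x))"
  define M where "M = distr K (trajectories V) (time_shift n)"
  define N where "N = scale_measure (emeasure (W a) (cyl V n x)) (W (x n))"
  have setsK: "sets K = sets (trajectories V)" by (simp add: K_def sets_W[OF a])
  have sh: "time_shift n \<in> K \<rightarrow>\<^sub>M trajectories V"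
    by (simp add: measurable_cong_sets[OF setsK refl] measurable_time_shift)
  have cyl: "cyl V n x \<in> sets (W a)" by (simp add: sets_W[OF a] sets_cyl)
  have emM: "emeasure M D = emeasure (W a) (cyl V n x \<inter> time_shift n -` D)"
    if "D \<in> sets (trajectories V)" for D
  proof -
    have sD: "time_shift n -` D \<inter> space K \<in> sets (W a)"
      using measurable_sets[OF sh that] by (simp add: K_def)
    have "emeasure M D = emeasure (W a) (cyl V n x \<inter> (time_shift n -` D \<inter> space K))"
      unfolding M_def emeasure_distr[OF sh that] using sD cyl
      by (subst K_def) (simp add: emeasure_density indicator_inter_arith[symmetric])
    also have "cyl V n x \<inter> (time_shift n -` D \<inter> space K) = cyl V n x \<inter> time_shift n -` D"
      by (auto simp: K_def space_W[OF a] cyl_def)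
    finally show ?thesis .
  qed
  have "M = N"
  proof (rule measure_eqI_cyl[OF countable_V])
    show "sets M = sets (trajectories V)" by (simp add: M_def)
    show "sets N = sets (trajectories V)" by (simp add: N_def sets_W[OF xn])
    show "finite_measure M"
    proof (rule finite_measureI)
      have "emeasure M (space M) = emeasure (W a) (cyl V n x \<inter> time_shift n -` space M)"
        by (rule emM) (simp add: M_def)
      then show "emeasure M (space M) \<noteq> \<infinity>" by simp
    qed
    fix m :: nat and z :: "nat \<Rightarrow> 'a" assume z: "\<And>i. i \<le> m \<Longrightarrow> z i \<in> V"
    have "emeasure M (cyl V m z) = emeasure (W a) (cyl V n x \<inter> time_shift n -` cyl V m z)"
      by (rule emM) (rule sets_cyl)
    also have "\<dots> = emeasure N (cyl V m z)"
      using markov_cyl_cyl[of a n x m z] a x z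
      by (simp add: N_def A.emeasure_eq_measure X.emeasure_eq_measure ennreal_mult'' )
    finally show "emeasure M (cyl V m z) = emeasure N (cyl V m z)" .
  qed
  then have "emeasure M C = emeasure N C" by simp
  then show ?thesis by (simp add: emM[OF C]) (simp add: N_def)
qed

text \<open>\<open>B\<close> splits into cylinders whose paths all end at \<open>c\<close>, so the
  factor \<open>emeasure (W c) C\<close> is common to all of them and comes out of the sum.\<close>

lemma markov:
  assumes a: "a \<in> V" and c: "c \<in> V" and B: "B \<in> sets (trajectories V)"
    and det: "determined_upto V n B" and Bc: "\<And>\<omega>. \<omega> \<in> B \<Longrightarrow> \<omega> n = c"
    and C: "C \<in> sets (trajectories V)"
  shows "measure (W a) (B \<inter> time_shift n -` C) = measure (W a) B * measure (W c) C"
proof -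
  interpret A: finite_measure "W a" using a by (rule finite_measure_W)
  interpret X: finite_measure "W c" using c by (rule finite_measure_W)
  have "time_shift n -` C \<inter> \<Omega> \<in> sets (trajectories V)"
    by (rule measurable_sets[OF measurable_time_shift C])
  moreover have "B \<inter> time_shift n -` C = B \<inter> (time_shift n -` C \<inter> \<Omega>)"
    using sets.sets_into_space[OF B] by auto
  ultimately have BC: "B \<inter> time_shift n -` C \<in> sets (W a)"
    using B by (simp add: sets_W[OF a])
  have BW: "B \<in> sets (W a)" using B by (simp add: sets_W[OF a])
  have step: "emeasure (W a) (B \<inter> time_shift n -` C \<inter> cyl V n x)
      = emeasure (W a) (B \<inter> cyl V n x) * emeasure (W c) C" if x: "x \<in> {..n} \<rightarrow>\<^sub>E V" for x
  proof (cases "B \<inter> cyl V n x = {}")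
    case True
    then have "B \<inter> time_shift n -` C \<inter> cyl V n x = {}" by auto
    with True show ?thesis by simp
  next
    case False
    then have eq: "B \<inter> cyl V n x = cyl V n x" using determined_cyl[OF det, of x] by auto
    obtain \<omega> where "\<omega> \<in> B" "\<omega> \<in> cyl V n x" using False by blast
    then have xn: "x n = c" using Bc by (auto simp: cyl_def)
    have "B \<inter> time_shift n -` C \<inter> cyl V n x = cyl V n x \<inter> time_shift n -` C" using eq by auto
    then show ?thesis using markov_cyl[OF a _ C, of n x] x eq xn by (auto simp: PiE_iff)
  qed
  have "emeasure (W a) (B \<inter> time_shift n -` C)
      = (\<integral>\<^sup>+x. emeasure (W a) (B \<inter> cyl V n x) * emeasure (W c) C \<partial>count_space ({..n} \<rightarrow>\<^sub>E V))"
    unfolding emeasure_split_cyl[OF countable_V sets_W[OF a] BC, of n]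
    by (intro nn_integral_cong) (simp add: step)
  also have "\<dots> = emeasure (W a) B * emeasure (W c) C"
    unfolding emeasure_split_cyl[OF countable_V sets_W[OF a] BW, of n]
    by (intro nn_integral_multc) simp
  finally show ?thesis
    by (simp add: A.emeasure_eq_measure X.emeasure_eq_measure ennreal_mult''[symmetric])
qed

lemma determined_coord_eq: "determined_upto V n {\<omega> \<in> \<Omega>. \<omega> n = c}"
  by (simp add: determined_upto_def)

text \<open>A single path from \<open>a\<close> to \<open>b\<close>, supplied by connectedness,
  already has positive probability.\<close>

lemma measure_coord_pos:
  assumes a: "a \<in> V" and b: "b \<in> V"
  shows "\<exists>m. 0 < measure (W a) {\<omega> \<in> \<Omega>. \<omega> m = b}"
proof -
  interpret A: finite_measure "W a" using a by (rule finite_measure_W)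
  let ?R = "\<lambda>u v. {u, v} \<in> E"
  have "?R\<^sup>*\<^sup>* a b" using connected a b by (simp add: connected_graph_def)
  then obtain m where "(?R ^^ m) a b" by (auto simp: rtranclp_is_Sup_relpowp)
  then obtain x where x: "x 0 = a" "x m = b" "\<And>i. i < m \<Longrightarrow> {x i, x (Suc i)} \<in> E"
    by (auto simp: relpowp_fun_conv)
  have EV: "u \<in> V \<and> v \<in> V" if "{u, v} \<in> E" for u v
    using that simple by (fastforce simp: simple_graph_def doubleton_eq_iff)
  have xV: "x i \<in> V" if "i \<le> m" for i
    using that x(3) EV a x(1) by (cases i) (auto simp: Suc_le_eq)
  have "0 < srw_trans E (x i) (x (Suc i))" if "i < m" for i
  proof -
    have "x (Suc i) \<in> nbrs E (x i)" using x(3)[OF that] by (simp add: nbrs_def)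
    moreover have "finite (nbrs E (x i))"
      using locally_finite xV[of i] that by (simp add: locally_finite_def)
    ultimately show ?thesis by (auto simp: srw_trans_def card_gt_0_iff)
  qed
  then have "0 < (\<Prod>i<m. srw_trans E (x i) (x (Suc i)))" by (intro prod_pos) auto
  then have "0 < measure (W a) (cyl V m x)" using measure_cyl[of a m x] a xV x(1) by simp
  also have "\<dots> \<le> measure (W a) {\<omega> \<in> \<Omega>. \<omega> m = b}"
    using x(2) by (intro A.finite_measure_mono) (auto simp: cyl_def sets_W[OF a] sets_coord_eq)
  finally show ?thesis by blast
qed

subsection \<open>Triviality of tail events\<close>

text \<open>The level sets of a stopping time, the first visit to \<open>a\<close> from time
  \<open>n\<close> on, with time \<open>n\<close> itself included. Working level by level reduces
  the strong Markov property to \<open>markov\<close> at fixed times.\<close>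

definition hit :: "'a \<Rightarrow> nat \<Rightarrow> nat \<Rightarrow> (nat \<Rightarrow> 'a) set" where
  "hit a n k = {\<omega> \<in> \<Omega>. \<omega> k = a \<and> n \<le> k \<and> (\<forall>t. n \<le> t \<and> t < k \<longrightarrow> \<omega> t \<noteq> a)}"

lemma sets_hit [measurable]: "hit a n k \<in> sets (trajectories V)"
  unfolding hit_def by measurable

lemma disjoint_hit: "disjoint_family (hit a n)"
  unfolding disjoint_family_on_def
proof (intro ballI impI)
  fix k l :: nat assume "k \<noteq> l"
  then show "hit a n k \<inter> hit a n l = {}"
    by (cases "k < l") (auto simp: hit_def linorder_neq_iff)
qed

lemma UN_hit: "(\<Union>k. hit a n k) = {\<omega> \<in> \<Omega>. \<exists>t\<ge>n. \<omega> t = a}"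
proof (intro equalityI subsetI)
  fix \<omega> assume \<omega>: "\<omega> \<in> {\<omega> \<in> \<Omega>. \<exists>t\<ge>n. \<omega> t = a}"
  define k where "k = (LEAST t. n \<le> t \<and> \<omega> t = a)"
  have "n \<le> k \<and> \<omega> k = a" 
    using LeastI_ex[of "\<lambda>t. n \<le> t \<and> \<omega> t = a"] \<omega> by (auto simp: k_def)
  moreover have "\<omega> t \<noteq> a" if "n \<le> t" "t < k" for t
    using that not_less_Least[of t "\<lambda>t. n \<le> t \<and> \<omega> t = a"] by (auto simp: k_def)
  ultimately show "\<omega> \<in> (\<Union>k. hit a n k)" using \<omega> by (auto simp: hit_def)
qed (auto simp: hit_def)

end

section \<open>Recurrence: infinitely many returns and the zero-one law\<close>

locale recurrent_srw_graph = srw_graph +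
  assumes recurrent: "recurrent_graph V E"
begin

text \<open>By the Markov property, being at \<open>a\<close> at time \<open>k\<close> and never
  again has probability 0 for each \<open>k\<close>. Almost surely, therefore, every visit is
  followed by a later one, and the walk starts at \<open>a\<close>.\<close>

lemma AE_return:
  assumes a: "a \<in> V"
  shows "AE \<omega> in W a. \<exists>t\<ge>n. \<omega> t = a"
proof -
  interpret prob_space "W a" using a by (rule prob_space_W)
  have meas: "S \<in> sets (trajectories V) \<Longrightarrow> S \<in> sets (W a)" for S by (simp add: sets_W[OF a])
  define N where "N = {\<omega> \<in> \<Omega>. \<forall>t\<ge>1. \<omega> t \<noteq> a}"
  have N: "N \<in> sets (trajectories V)" unfolding N_def by measurable
  have "N = space (W a) - {\<omega> \<in> space (W a). \<exists>t\<ge>1. \<omega> t = a}"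
    by (auto simp: N_def space_W[OF a])
  moreover have "{\<omega> \<in> \<Omega>. \<exists>t\<ge>1. \<omega> t = a} \<in> sets (trajectories V)" by measurable
  then have "{\<omega> \<in> space (W a). \<exists>t\<ge>1. \<omega> t = a} \<in> events"
    unfolding space_W[OF a] by (rule meas)
  note prob_compl[OF this]
  moreover have "prob {\<omega> \<in> space (W a). \<exists>t\<ge>1. \<omega> t = a} = 1"
    using recurrent a unfolding recurrent_graph_def by blast
  ultimately have "prob N = 0" by simp
  then have null: "prob ({\<omega> \<in> \<Omega>. \<omega> k = a} \<inter> time_shift k -` N) = 0" for k
    using markov[OF a a sets_coord_eq determined_coord_eq _ N] by simp
  have AE_k: "AE \<omega> in W a. \<omega> k = a \<longrightarrow> time_shift k \<omega> \<notin> N" for k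
  proof -
    have "{\<omega> \<in> \<Omega>. \<omega> k = a} \<inter> time_shift k -` N = {\<omega> \<in> \<Omega>. \<omega> k = a} \<inter> (time_shift k -` N \<inter> \<Omega>)" by auto
    moreover have "{\<omega> \<in> \<Omega>. \<omega> k = a} \<inter> (time_shift k -` N \<inter> \<Omega>) \<in> sets (trajectories V)"
      using measurable_sets[OF measurable_time_shift N] by (intro sets.Int[OF sets_coord_eq])
    ultimately have "{\<omega> \<in> \<Omega>. \<omega> k = a} \<inter> time_shift k -` N \<in> null_sets (W a)"
      using null[of k] meas by (intro null_setsI) (simp_all only: emeasure_eq_measure ennreal_0)
    from AE_not_in[OF this] AE_space show ?thesis
      by eventually_elim (auto simp: space_W[OF a])
  qed
  have "prob (cyl V 0 (\<lambda>_. a)) = 1" using measure_cyl[OF a, of 0 "\<lambda>_. a"] a by simp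
  then have start: "AE \<omega> in W a. \<omega> \<in> cyl V 0 (\<lambda>_. a)"
    using prob_eq_1[OF meas[OF sets_cyl]] by simp
  have "AE \<omega> in W a. \<forall>k. \<omega> k = a \<longrightarrow> time_shift k \<omega> \<notin> N" using AE_k by (simp add: AE_all_countable)
  with start AE_space show ?thesis
  proof eventually_elim
    fix \<omega> assume init: "\<omega> \<in> cyl V 0 (\<lambda>_. a)" and \<omega>: "\<omega> \<in> space (W a)"
      and ret: "\<forall>k. \<omega> k = a \<longrightarrow> time_shift k \<omega> \<notin> N"
    have ret': "\<exists>t>k. \<omega> t = a" if "\<omega> k = a" for k
    proof -
      have "time_shift k \<omega> \<in> \<Omega>" using \<omega> by (auto simp: space_W[OF a] space_trajectories time_shift_def)
      moreover have "time_shift k \<omega> \<notin> N" using ret that by blast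
      ultimately obtain t where "1 \<le> t" "\<omega> (t + k) = a" by (auto simp: N_def time_shift_def)
      then show ?thesis by (intro exI[of _ "t + k"]) auto
    qed
    show "\<exists>t\<ge>n. \<omega> t = a"
    proof (induction n)
      case 0 show ?case using init by (auto simp: cyl_def)
    next
      case (Suc n)
      then show ?case using ret' by (metis Suc_leI le_less_trans)
    qed
  qed
qed

text \<open>A tail event is given by a family \<open>A\<close>, where \<open>A m\<close> is the event as seen by a walk whose clock started
  at time \<open>m\<close>.\<close>

lemma regeneration:
  assumes a: "a \<in> V" and B: "B \<in> sets (trajectories V)" "determined_upto V n B"
    and A: "\<And>m. A m \<in> sets (trajectories V)"
    and inv: "\<And>m k \<omega>. \<omega> \<in> \<Omega> \<Longrightarrow> time_shift k \<omega> \<in> A (m + k) \<longleftrightarrow> \<omega> \<in> A m"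
  shows "(\<lambda>k. measure (W a) (B \<inter> hit a n k) * measure (W a) (A (m + k))) sums measure (W a) (A m \<inter> B)"
proof -
  interpret prob_space "W a" using a by (rule prob_space_W)
  have meas: "S \<in> sets (trajectories V) \<Longrightarrow> S \<in> sets (W a)" for S by (simp add: sets_W[OF a])
  have "prob (A m \<inter> B \<inter> hit a n k) = prob (B \<inter> hit a n k) * prob (A (m + k))" for k
  proof (cases "n \<le> k")
    case False
    then have "hit a n k = {}" by (auto simp: hit_def)
    then show ?thesis by simp
  next
    case True
    have "determined_upto V k (B \<inter> hit a n k)"
      unfolding determined_upto_def
    proof (intro ballI impI)
      fix \<omega> \<omega>' assume *: "\<omega> \<in> \<Omega>" "\<omega>' \<in> \<Omega>" "\<forall>i\<le>k. \<omega> i = \<omega>' i"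
      have "\<forall>i\<le>n. \<omega> i = \<omega>' i" using *(3) True by (meson order_trans)
      then have "\<omega> \<in> B \<longleftrightarrow> \<omega>' \<in> B" using B(2) *(1,2) unfolding determined_upto_def by blast
      moreover have "\<omega> \<in> hit a n k \<longleftrightarrow> \<omega>' \<in> hit a n k"
      proof -
        have "\<omega> t = \<omega>' t" if "t \<le> k" for t using *(3) that by blast
        then show ?thesis using *(1,2) by (simp add: hit_def)
      qed
      ultimately show "\<omega> \<in> B \<inter> hit a n k \<longleftrightarrow> \<omega>' \<in> B \<inter> hit a n k" by blast
    qed
    then have "prob (B \<inter> hit a n k \<inter> time_shift k -` A (m + k)) = prob (B \<inter> hit a n k) * prob (A (m + k))"
      by (intro markov[OF a a _ _ _ A] sets.Int B sets_hit) (simp_all add: hit_def)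
    \<comment> \<open>The tail event is read off the trajectory after the visit, with the clock
      advanced by \<open>k\<close>.\<close>
    moreover have "A m \<inter> B \<inter> hit a n k = B \<inter> hit a n k \<inter> time_shift k -` A (m + k)"
      using inv by (auto simp: hit_def)
    ultimately show ?thesis by simp
  qed
  moreover have "(\<lambda>k. prob (A m \<inter> B \<inter> hit a n k)) sums prob (\<Union>k. A m \<inter> B \<inter> hit a n k)"
  proof (rule finite_measure_UNION)
    show "range (\<lambda>k. A m \<inter> B \<inter> hit a n k) \<subseteq> events" using A B by (auto intro!: meas)
    show "disjoint_family (\<lambda>k. A m \<inter> B \<inter> hit a n k)"
      using disjoint_hit[of a n] unfolding disjoint_family_on_def by blast
  qed
  \<comment> \<open>Recurrence enters here: the events \<open>hit a n k\<close> cover almost all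
    trajectories.\<close>
  moreover have "prob (\<Union>k. A m \<inter> B \<inter> hit a n k) = prob (A m \<inter> B)"
  proof (rule finite_measure_eq_AE)
    show "AE \<omega> in W a. \<omega> \<in> (\<Union>k. A m \<inter> B \<inter> hit a n k) \<longleftrightarrow> \<omega> \<in> A m \<inter> B"
      using AE_return[OF a, of n] AE_space
    proof eventually_elim
      fix \<omega> assume "\<exists>t\<ge>n. \<omega> t = a" "\<omega> \<in> space (W a)"
      then have "\<omega> \<in> (\<Union>k. hit a n k)" by (simp add: UN_hit space_W[OF a])
      then show "\<omega> \<in> (\<Union>k. A m \<inter> B \<inter> hit a n k) \<longleftrightarrow> \<omega> \<in> A m \<inter> B" by auto
    qed
  qed (use A B in \<open>auto intro!: meas sets.countable_UN\<close>)
  ultimately show ?thesis by simp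
qed

text \<open>By \<open>regeneration\<close>, \<open>g\<close> is harmonic for visiting-time weights,
  hence equal to \<open>g 0\<close> at each possible visiting time of \<open>a\<close>. So
  \<open>A 0\<close> is independent of every cylinder, and then of itself.\<close>

lemma tail_0_1:
  assumes a: "a \<in> V" and A: "\<And>m. A m \<in> sets (trajectories V)"
    and inv: "\<And>m k \<omega>. \<omega> \<in> \<Omega> \<Longrightarrow> time_shift k \<omega> \<in> A (m + k) \<longleftrightarrow> \<omega> \<in> A m"
  shows "measure (W a) (A 0) \<in> {0, 1}"
proof -
  interpret prob_space "W a" using a by (rule prob_space_W)
  have meas: "S \<in> sets (trajectories V) \<Longrightarrow> S \<in> sets (W a)" for S by (simp add: sets_W[OF a])
  define g where "g m = prob (A m)" for m
  have regen: "(\<lambda>k. prob (B \<inter> hit a n k) * g (m + k)) sums prob (A m \<inter> B)"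
    and weights: "(\<lambda>k. prob (B \<inter> hit a n k)) sums prob B"
    if B: "B \<in> sets (trajectories V)" "determined_upto V n B" for B n m
  proof -
    show "(\<lambda>k. prob (B \<inter> hit a n k) * g (m + k)) sums prob (A m \<inter> B)"
      unfolding g_def by (rule regeneration[OF a B A inv])
    \<comment> \<open>The sure event also forms a tail family; its regeneration identity says that
      the weights add up to \<open>prob B\<close>.\<close>
    have "(\<lambda>k. prob (B \<inter> hit a n k) * prob \<Omega>) sums prob (\<Omega> \<inter> B)"
      by (rule regeneration[OF a B, of "\<lambda>_. \<Omega>"]) (auto simp: space_trajectories time_shift_def)
    then show "(\<lambda>k. prob (B \<inter> hit a n k)) sums prob B"
      using sets.sets_into_space[OF B(1)] by (simp add: measure_W_\<Omega>[OF a] Int_absorb1)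
  qed
  \<comment> \<open>The weights are those of the first visit from time \<open>j\<close> on, not of
    the first return: then the weight at \<open>j\<close> is the whole probability of being at
    \<open>a\<close> at time \<open>j\<close>, positive by assumption.\<close>
  have periodic: "g (m + j) = g m" if j: "0 < prob {\<omega> \<in> \<Omega>. \<omega> j = a}" for m j
  proof (rule bounded_harmonic_periodic)
    have \<Omega>: "\<Omega> \<in> sets (trajectories V)" "determined_upto V j \<Omega>" by (auto simp: determined_upto_def)
    show "(\<lambda>k. prob (\<Omega> \<inter> hit a j k)) sums 1" using weights[OF \<Omega>] by (simp add: measure_W_\<Omega>[OF a])
    show "(\<lambda>k. prob (\<Omega> \<inter> hit a j k) * g (m + k)) sums g m" for m
      using regen[OF \<Omega>, of m] sets.sets_into_space[OF A[of m]] by (simp add: g_def Int_absorb2)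
    have "\<Omega> \<inter> hit a j j = {\<omega> \<in> \<Omega>. \<omega> j = a}" by (auto simp: hit_def)
    with j show "0 < prob (\<Omega> \<inter> hit a j j)" by simp
    show "\<bar>g m\<bar> \<le> 1" for m by (simp add: g_def)
  qed simp
  have indep: "prob (A 0 \<inter> cyl V n x) = g 0 * prob (cyl V n x)" for n x
  proof -
    have det: "determined_upto V n (cyl V n x)" by (auto simp: determined_upto_def cyl_def)
    \<comment> \<open>A nonzero weight at \<open>k\<close> makes \<open>k\<close> a possible
      visiting time of \<open>a\<close>, so periodicity replaces \<open>g k\<close> by the constant
      \<open>g 0\<close>.\<close>
    have "prob (cyl V n x \<inter> hit a n k) * g (0 + k) = prob (cyl V n x \<inter> hit a n k) * g 0" for k
    proof (cases "prob (cyl V n x \<inter> hit a n k) = 0")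
      case False
      then have "0 < prob (cyl V n x \<inter> hit a n k)" by (simp add: zero_less_measure_iff)
      also have "\<dots> \<le> prob {\<omega> \<in> \<Omega>. \<omega> k = a}"
        by (intro finite_measure_mono meas sets_coord_eq) (auto simp: hit_def)
      finally show ?thesis using periodic[of k 0] by simp
    qed simp
    then have "(\<lambda>k. prob (cyl V n x \<inter> hit a n k) * g 0) sums prob (A 0 \<inter> cyl V n x)"
      using regen[OF sets_cyl det, of 0] by (simp only:)
    moreover have "(\<lambda>k. prob (cyl V n x \<inter> hit a n k) * g 0) sums (prob (cyl V n x) * g 0)"
      by (intro sums_mult2 weights sets_cyl det)
    ultimately show ?thesis by (simp add: sums_unique2 mult.commute)
  qed
  \<comment> \<open>The law restricted to \<open>A 0\<close> and the law scaled by
    \<open>g 0\<close> agree on cylinders, hence everywhere; evaluating both at \<open>A 0\<close>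
    gives \<open>g 0 = g 0 * g 0\<close>.\<close>
  define M where "M = density (W a) (indicator (A 0))"
  define N where "N = scale_measure (ennreal (g 0)) (W a)"
  have M: "emeasure M B = prob (A 0 \<inter> B)" if "B \<in> sets (trajectories V)" for B
    unfolding M_def using meas[OF that] meas[OF A[of 0]]
    by (simp add: emeasure_density indicator_inter_arith[symmetric] emeasure_eq_measure)
  have N: "emeasure N B = ennreal (g 0 * prob B)" for B
    by (simp add: N_def emeasure_eq_measure ennreal_mult'' g_def)
  have "M = N"
  proof (rule measure_eqI_cyl[OF countable_V])
    show "sets M = sets (trajectories V)" "sets N = sets (trajectories V)"
      by (simp_all add: M_def N_def sets_W[OF a])
    show "finite_measure M"
      using M[of "space M"] by (intro finite_measureI) (simp add: M_def space_W[OF a])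
  qed (simp add: M N indep sets_cyl)
  then have "prob (A 0 \<inter> A 0) = g 0 * prob (A 0)"
    using M[OF A[of 0]] N[of "A 0"] by (simp add: g_def)
  then show ?thesis by (auto simp: g_def)
qed

end
subsection \<open>Collisions\<close>

lemma frequently_sequentially_seg:
  "(\<exists>\<^sub>F t in sequentially. P (t + k)) \<longleftrightarrow> (\<exists>\<^sub>F t in sequentially. P t)"
  using eventually_sequentially_seg[of "\<lambda>t. \<not> P t" k] by (simp add: frequently_def)

context recurrent_srw_graph
begin

definition collide :: "(nat \<Rightarrow> 'a) \<Rightarrow> (nat \<Rightarrow> 'a) set" where
  "collide y = {x \<in> \<Omega>. \<exists>\<^sub>F t in sequentially. x t = y t}"

definition collisions :: "((nat \<Rightarrow> 'a) \<times> (nat \<Rightarrow> 'a)) set" where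
  "collisions = {p \<in> \<Omega> \<times> \<Omega>. \<exists>\<^sub>F t in sequentially. fst p t = snd p t}"

text \<open>Countability of \<open>V\<close> makes a meeting at time \<open>t\<close> a countable
  union of measurable rectangles.\<close>

lemma sets_collisions:
  "collisions \<in> sets (trajectories V \<Otimes>\<^sub>M trajectories V)" (is "_ \<in> sets ?TT")
proof -
  have meet: "{p \<in> \<Omega> \<times> \<Omega>. fst p t = snd p t} \<in> sets ?TT" for t
  proof -
    have "{p \<in> \<Omega> \<times> \<Omega>. fst p t = snd p t}
        = (\<Union>v\<in>V. {\<omega> \<in> \<Omega>. \<omega> t = v} \<times> {\<omega> \<in> \<Omega>. \<omega> t = v})"
      by (auto simp: space_trajectories)
    also have "\<dots> \<in> sets ?TT"
      using countable_V by (intro sets.countable_UN' pair_measureI sets_coord_eq) auto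
    finally show ?thesis .
  qed
  have "collisions = (\<Inter>n. \<Union>t\<in>{n..}. {p \<in> \<Omega> \<times> \<Omega>. fst p t = snd p t})"
    by (auto simp: collisions_def frequently_def eventually_sequentially)
  also have "\<dots> \<in> sets ?TT"
    using meet by (intro sets.countable_INT sets.countable_UN' image_subsetI) auto
  finally show ?thesis .
qed

text \<open>Collision is symmetric in the two trajectories, so \<open>collide\<close> serves for
  freezing either walk.\<close>

lemma collisions_sections:
  assumes "y \<in> \<Omega>"
  shows "Pair y -` collisions = collide y" "(\<lambda>x. (x, y)) -` collisions = collide y"
  using assms by (auto simp: collisions_def collide_def eq_commute)

lemma sets_collide: "y \<in> \<Omega> \<Longrightarrow> collide y \<in> sets (trajectories V)"
  using sets_Pair1[OF sets_collisions, of y] by (simp add: collisions_sections)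

lemma time_shift_in_\<Omega>: "\<omega> \<in> \<Omega> \<Longrightarrow> time_shift k \<omega> \<in> \<Omega>"
  by (simp add: space_trajectories time_shift_def)

text \<open>For frozen \<open>y\<close> this is a tail event in the sense of
  \<open>tail_0_1\<close>, with \<open>A m\<close> built from \<open>y\<close> as seen from time
  \<open>m\<close>.\<close>

lemma collide_0_1:
  assumes a: "a \<in> V" and y: "y \<in> \<Omega>"
  shows "measure (W a) (collide y) \<in> {0, 1}"
proof -
  have "measure (W a) (collide (time_shift 0 y)) \<in> {0, 1}"
  proof (rule tail_0_1[OF a, of "\<lambda>m. collide (time_shift m y)"])
    show "collide (time_shift m y) \<in> sets (trajectories V)" for m
      by (rule sets_collide[OF time_shift_in_\<Omega>[OF y]])
    show "time_shift k \<omega> \<in> collide (time_shift (m + k) y) \<longleftrightarrow> \<omega> \<in> collide (time_shift m y)"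
      if "\<omega> \<in> \<Omega>" for m k \<omega>
      using that time_shift_in_\<Omega>[OF that, of k]
        frequently_sequentially_seg[of "\<lambda>t. \<omega> t = y (t + m)" k]
      by (simp add: collide_def time_shift_def ac_simps)
  qed
  then show ?thesis by (simp add: time_shift_def)
qed

text \<open>By \<open>collide_0_1\<close> the probability is 0 at all other trajectories, so the
  indicator of this set is the conditional probability of infinitely many collisions given the other
  walk.\<close>

definition full :: "'a \<Rightarrow> (nat \<Rightarrow> 'a) set" where
  "full a = {y \<in> \<Omega>. measure (W a) (collide y) = 1}"

lemma sets_full:
  assumes a: "a \<in> V"
  shows "full a \<in> sets (trajectories V)"
proof -
  interpret prob_space "W a" using a by (rule prob_space_W)
  have "collisions \<in> sets (trajectories V \<Otimes>\<^sub>M W a)"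
    using sets_collisions by (simp add: sets_pair_measure_cong[OF refl sets_W[OF a]])
  from measurable_emeasure_Pair[OF this]
  have "(\<lambda>y. emeasure (W a) (collide y)) \<in> borel_measurable (trajectories V)"
    by (rule measurable_cong[THEN iffD1, rotated]) (simp add: collisions_sections)
  then have "(\<lambda>y. measure (W a) (collide y)) \<in> borel_measurable (trajectories V)"
    unfolding measure_def by measurable
  then show ?thesis unfolding full_def by measurable
qed

lemma emeasure_collide:
  assumes a: "a \<in> V" and y: "y \<in> \<Omega>"
  shows "emeasure (W a) (collide y) = indicator (full a) y"
proof -
  interpret prob_space "W a" using a by (rule prob_space_W)
  show ?thesis
    using collide_0_1[OF a y] y by (auto simp: emeasure_eq_measure full_def split: split_indicator)
qed

section \<open>The joint law of the two walks\<close>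

lemma sets_indep_walks:
  assumes "a \<in> V" "b \<in> V"
  shows "sets (indep_walks V E a b) = sets (trajectories V \<Otimes>\<^sub>M trajectories V)"
  unfolding indep_walks_def using assms by (intro sets_pair_measure_cong sets_W)

lemma space_indep_walks:
  assumes "a \<in> V" "b \<in> V"
  shows "space (indep_walks V E a b) = \<Omega> \<times> \<Omega>"
  unfolding indep_walks_def using assms by (simp add: space_pair_measure space_W)

lemma prob_space_indep_walks:
  assumes "a \<in> V" "b \<in> V"
  shows "prob_space (indep_walks V E a b)"
proof -
  interpret A: prob_space "W a" using assms by (intro prob_space_W)
  interpret B: prob_space "W b" using assms by (intro prob_space_W)
  interpret pair_prob_space "W a" "W b" ..
  show ?thesis unfolding indep_walks_def by unfold_locales
qed

lemma num_collisions_eq: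
  assumes "a \<in> V" "b \<in> V"
  shows "{\<omega> \<in> space (indep_walks V E a b). num_collisions \<omega> = \<infinity>} = collisions"
  using space_indep_walks[OF assms]
  by (auto simp: collisions_def num_collisions_def suminf_of_bool_eq_top_iff[unfolded infinity_ennreal_def])

text \<open>Freezing \<open>Y\<close> or freezing \<open>X\<close> gives the two formulas for the
  same probability \<open>p\<close>. Almost every collision pair has \<open>X\<close> in
  \<open>full b\<close> and \<open>Y\<close> in \<open>full a\<close>, so independence yields
  \<open>p \<le> p * p\<close>.\<close>

lemma measure_collisions:
  assumes a: "a \<in> V" and b: "b \<in> V"
  shows "measure (indep_walks V E a b) collisions = measure (W b) (full a)"
    and "measure (indep_walks V E a b) collisions = measure (W a) (full b)"
    and "measure (indep_walks V E a b) collisions \<in> {0, 1}"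
proof -
  let ?M = "indep_walks V E a b"
  interpret A: prob_space "W a" using a by (rule prob_space_W)
  interpret B: prob_space "W b" using b by (rule prob_space_W)
  interpret P: pair_sigma_finite "W a" "W b" ..
  interpret M: prob_space ?M using a b by (rule prob_space_indep_walks)
  have sets: "sets (W a \<Otimes>\<^sub>M W b) = sets (trajectories V \<Otimes>\<^sub>M trajectories V)"
    using sets_indep_walks[OF a b] by (simp add: indep_walks_def)
  have C: "collisions \<in> sets (W a \<Otimes>\<^sub>M W b)" using sets_collisions sets by simp
  have full: "full a \<in> sets (W b)" "full b \<in> sets (W a)"
    using sets_full a b by (simp_all add: sets_W)
  have "emeasure ?M collisions = (\<integral>\<^sup>+y. indicator (full a) y \<partial>W b)"
    unfolding indep_walks_def P.emeasure_pair_measure_alt2[OF C]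
    by (intro nn_integral_cong) (simp add: space_W[OF b] collisions_sections emeasure_collide[OF a])
  then show 1: "measure ?M collisions = measure (W b) (full a)"
    using full by (simp add: measure_def)
  have "emeasure ?M collisions = (\<integral>\<^sup>+x. indicator (full b) x \<partial>W a)"
    unfolding indep_walks_def B.emeasure_pair_measure_alt[OF C]
    by (intro nn_integral_cong) (simp add: space_W[OF a] collisions_sections emeasure_collide[OF b])
  then show 2: "measure ?M collisions = measure (W a) (full b)"
    using full by (simp add: measure_def)
  \<comment> \<open>The collision pairs in which \<open>Y\<close>, respectively \<open>X\<close>,
    lies outside its side of the rectangle; each section over such a frozen trajectory is null by
    the zero-one law.\<close>
  let ?C1 = "collisions - \<Omega> \<times> full a" and ?C2 = "collisions - full b \<times> \<Omega>"
  have "\<Omega> \<in> sets (W a)" "\<Omega> \<in> sets (W b)" using a b by (simp_all add: sets_W)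
  with full C have C1: "?C1 \<in> sets (W a \<Otimes>\<^sub>M W b)" and C2: "?C2 \<in> sets (W a \<Otimes>\<^sub>M W b)"
    and QQ: "full b \<times> full a \<in> sets (W a \<Otimes>\<^sub>M W b)"
    by (auto intro!: sets.Diff pair_measureI)
  have "emeasure ?M ?C1 = (\<integral>\<^sup>+y. 0 \<partial>W b)"
    unfolding indep_walks_def P.emeasure_pair_measure_alt2[OF C1]
  proof (rule nn_integral_cong)
    fix y assume "y \<in> space (W b)"
    then have y: "y \<in> \<Omega>" by (simp add: space_W[OF b])
    have "(\<lambda>x. (x, y)) -` ?C1 = (\<lambda>x. (x, y)) -` collisions - (if y \<in> full a then \<Omega> else {})" by auto
    also have "\<dots> = (if y \<in> full a then {} else collide y)"
      unfolding collisions_sections[OF y] by (auto simp: collide_def)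
    finally have "(\<lambda>x. (x, y)) -` ?C1 = (if y \<in> full a then {} else collide y)" .
    then show "emeasure (W a) ((\<lambda>x. (x, y)) -` ?C1) = 0"
      using emeasure_collide[OF a y] by simp
  qed
  then have z1: "measure ?M ?C1 = 0" by (simp add: measure_def)
  have "emeasure ?M ?C2 = (\<integral>\<^sup>+x. 0 \<partial>W a)"
    unfolding indep_walks_def B.emeasure_pair_measure_alt[OF C2]
  proof (rule nn_integral_cong)
    fix x assume "x \<in> space (W a)"
    then have x: "x \<in> \<Omega>" by (simp add: space_W[OF a])
    have "Pair x -` ?C2 = Pair x -` collisions - (if x \<in> full b then \<Omega> else {})" by auto
    also have "\<dots> = (if x \<in> full b then {} else collide x)"
      unfolding collisions_sections[OF x] by (auto simp: collide_def)
    finally have "Pair x -` ?C2 = (if x \<in> full b then {} else collide x)" .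
    then show "emeasure (W b) (Pair x -` ?C2) = 0"
      using emeasure_collide[OF b x] by simp
  qed
  then have z2: "measure ?M ?C2 = 0" by (simp add: measure_def)
  have "emeasure ?M (full b \<times> full a) = emeasure (W a) (full b) * emeasure (W b) (full a)"
    unfolding indep_walks_def by (rule B.emeasure_pair_measure_Times) fact+
  then have times: "measure ?M (full b \<times> full a) = measure (W a) (full b) * measure (W b) (full a)"
    by (simp add: measure_def enn2real_mult)
  have ev: "?C1 \<in> M.events" "?C2 \<in> M.events" "full b \<times> full a \<in> M.events"
    using C1 C2 QQ by (simp_all add: indep_walks_def)
  have "measure ?M collisions \<le> measure ?M (?C1 \<union> ?C2 \<union> full b \<times> full a)"
    using ev by (intro M.finite_measure_mono sets.Un) (auto simp: collisions_def)
  also have "\<dots> \<le> measure ?M ?C1 + measure ?M ?C2 + measure ?M (full b \<times> full a)"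
    using measure_Un_le[of "?C1 \<union> ?C2" ?M "full b \<times> full a"] measure_Un_le[of ?C1 ?M ?C2] ev
    by (simp add: sets.Un)
  \<comment> \<open>Both sides of the rectangle have probability \<open>p\<close>, by the two
    formulas already shown.\<close>
  also have "\<dots> = measure ?M collisions * measure ?M collisions"
    using z1 z2 times 1 2 by simp
  finally have "measure ?M collisions * (1 - measure ?M collisions) \<le> 0"
    by (simp add: algebra_simps)
  moreover have "0 \<le> measure ?M collisions * (1 - measure ?M collisions)" by simp
  ultimately have "measure ?M collisions * (1 - measure ?M collisions) = 0" by linarith
  then show "measure ?M collisions \<in> {0, 1}" by auto
qed

text \<open>The Markov property at time \<open>m\<close> is applied to \<open>X\<close> with
  \<open>Y\<close> frozen, and then to \<open>Y\<close>; positive probability suffices each time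
  because of the zero-one laws.\<close>

lemma collisions_pos_step:
  assumes a: "a \<in> V" and b: "b \<in> V" and a': "a' \<in> V" and b': "b' \<in> V"
    and pos: "0 < measure (indep_walks V E a' b') collisions"
    and X: "0 < measure (W a) {\<omega> \<in> \<Omega>. \<omega> m = a'}" and Y: "0 < measure (W b) {\<omega> \<in> \<Omega>. \<omega> m = b'}"
  shows "measure (indep_walks V E a b) collisions = 1"
proof -
  interpret A: prob_space "W a" using a by (rule prob_space_W)
  interpret B: prob_space "W b" using b by (rule prob_space_W)
  \<comment> \<open>With positive probability the walk from \<open>a\<close> is at \<open>a'\<close>
    at time \<open>m\<close>, after which it almost surely meets the shifted \<open>y\<close>
    infinitely often; \<open>collide_0_1\<close> raises this positive probability to 1.\<close>
  have sub: "{\<omega> \<in> \<Omega>. \<omega> m = b'} \<inter> time_shift m -` full a' \<subseteq> full a"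
  proof
    fix y assume y: "y \<in> {\<omega> \<in> \<Omega>. \<omega> m = b'} \<inter> time_shift m -` full a'"
    then have y\<Omega>: "y \<in> \<Omega>" and sh: "time_shift m y \<in> \<Omega>" by (auto simp: full_def)
    have "measure (W a) ({\<omega> \<in> \<Omega>. \<omega> m = a'} \<inter> time_shift m -` collide (time_shift m y))
       = measure (W a) {\<omega> \<in> \<Omega>. \<omega> m = a'} * measure (W a') (collide (time_shift m y))"
      using markov[OF a a' sets_coord_eq determined_coord_eq _ sets_collide[OF sh]] by simp
    also have "\<dots> > 0" using X y by (simp add: full_def)
    also have "{\<omega> \<in> \<Omega>. \<omega> m = a'} \<inter> time_shift m -` collide (time_shift m y) \<subseteq> collide y"
      using frequently_sequentially_seg[of "\<lambda>t. _ t = y t" m]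
      by (auto simp: collide_def time_shift_def)
    then have "measure (W a) ({\<omega> \<in> \<Omega>. \<omega> m = a'} \<inter> time_shift m -` collide (time_shift m y))
        \<le> measure (W a) (collide y)"
      using sets_collide[OF y\<Omega>] by (intro A.finite_measure_mono) (simp_all add: sets_W[OF a])
    finally have "0 < measure (W a) (collide y)" .
    then show "y \<in> full a" using collide_0_1[OF a y\<Omega>] y\<Omega> by (auto simp: full_def)
  qed
  have "0 < measure (W b) {\<omega> \<in> \<Omega>. \<omega> m = b'} * measure (W b') (full a')"
    using Y pos measure_collisions(1)[OF a' b'] by simp
  also have "\<dots> = measure (W b) ({\<omega> \<in> \<Omega>. \<omega> m = b'} \<inter> time_shift m -` full a')"
    using markov[OF b b' sets_coord_eq determined_coord_eq _ sets_full[OF a']] by simp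
  also have "\<dots> \<le> measure (W b) (full a)"
    using sets_full[OF a] by (intro B.finite_measure_mono sub) (simp add: sets_W[OF b])
  finally show ?thesis
    using measure_collisions(1,3)[OF a b] by auto
qed

lemma measure_pair_position:
  assumes a: "a \<in> V" and b: "b \<in> V"
  shows "\<P>((X, Y) in indep_walks V E a b. X m = a' \<and> Y m = b')
    = measure (W a) {\<omega> \<in> \<Omega>. \<omega> m = a'} * measure (W b) {\<omega> \<in> \<Omega>. \<omega> m = b'}"
proof -
  interpret B: prob_space "W b" using b by (rule prob_space_W)
  have "{(X, Y). (X, Y) \<in> space (indep_walks V E a b) \<and> X m = a' \<and> Y m = b'}
      = {\<omega> \<in> \<Omega>. \<omega> m = a'} \<times> {\<omega> \<in> \<Omega>. \<omega> m = b'}"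
    by (auto simp: space_indep_walks[OF a b])
  moreover have "emeasure (indep_walks V E a b) ({\<omega> \<in> \<Omega>. \<omega> m = a'} \<times> {\<omega> \<in> \<Omega>. \<omega> m = b'})
      = emeasure (W a) {\<omega> \<in> \<Omega>. \<omega> m = a'} * emeasure (W b) {\<omega> \<in> \<Omega>. \<omega> m = b'}"
    unfolding indep_walks_def
    by (rule B.emeasure_pair_measure_Times) (simp_all add: sets_W[OF a] sets_W[OF b] sets_coord_eq)
  ultimately show ?thesis by (simp only: measure_def enn2real_mult)
qed

end

theorem proposition2p1:
  fixes V :: "'a set" and E :: "'a set set"
  assumes "simple_graph V E" and "locally_finite V E"
    and "connected_graph V E" and "recurrent_graph V E"
  shows "(\<forall>a\<in>V. \<forall>b\<in>V. \<P>(\<omega> in indep_walks V E a b. num_collisions \<omega> = \<infinity>) \<in> {0, 1})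
    \<and> (\<forall>a\<^sub>0\<in>V. \<forall>b\<^sub>0\<in>V. \<P>(\<omega> in indep_walks V E a\<^sub>0 b\<^sub>0. num_collisions \<omega> = \<infinity>) > 0 \<longrightarrow>
        (\<forall>a\<in>V. \<forall>b\<in>V.
           (\<exists>m. \<P>((X, Y) in indep_walks V E a b. X m = a\<^sub>0 \<and> Y m = b\<^sub>0) > 0) \<longrightarrow>
           \<P>(\<omega> in indep_walks V E a b. num_collisions \<omega> = \<infinity>) = 1))
    \<and> ((\<forall>a\<in>V. \<P>(\<omega> in indep_walks V E a a. num_collisions \<omega> = \<infinity>) = 0) \<or>
       (\<forall>a\<in>V. \<P>(\<omega> in indep_walks V E a a. num_collisions \<omega> = \<infinity>) = 1))"
proof -
  interpret recurrent_srw_graph V E by unfold_locales fact+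
  let ?P = "\<lambda>a b. \<P>(\<omega> in indep_walks V E a b. num_collisions \<omega> = \<infinity>)"
  have P: "?P a b = measure (indep_walks V E a b) collisions" if "a \<in> V" "b \<in> V" for a b
    using num_collisions_eq[OF that] by simp
  have zero_one: "?P a b \<in> {0, 1}" if "a \<in> V" "b \<in> V" for a b
    unfolding P[OF that] by (rule measure_collisions(3)[OF that])
  have pos: "?P a b = 1"
    if V: "a\<^sub>0 \<in> V" "b\<^sub>0 \<in> V" "a \<in> V" "b \<in> V" and "0 < ?P a\<^sub>0 b\<^sub>0"
      and "0 < \<P>((X, Y) in indep_walks V E a b. X m = a\<^sub>0 \<and> Y m = b\<^sub>0)" for a\<^sub>0 b\<^sub>0 a b m
  proof -
    have "0 < measure (W a) {\<omega> \<in> \<Omega>. \<omega> m = a\<^sub>0}" "0 < measure (W b) {\<omega> \<in> \<Omega>. \<omega> m = b\<^sub>0}"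
      using that(6) unfolding measure_pair_position[OF V(3,4)]
      by (auto simp: zero_less_mult_iff measure_le_0_iff not_less[symmetric])
    then show ?thesis
      using that(5) unfolding P[OF V(1,2)] P[OF V(3,4)]
      by (intro collisions_pos_step[OF V(3,4,1,2)])
  qed
  have diag: "?P a a = 1" if V: "a\<^sub>0 \<in> V" "a \<in> V" and "?P a\<^sub>0 a\<^sub>0 \<noteq> 0" for a\<^sub>0 a
  proof -
    \<comment> \<open>Both walks start at \<open>a\<close>, so the same \<open>m\<close> serves for
      both and no parity obstruction arises.\<close>
    obtain m where "0 < measure (W a) {\<omega> \<in> \<Omega>. \<omega> m = a\<^sub>0}" using measure_coord_pos V by blast
    then have "0 < \<P>((X, Y) in indep_walks V E a a. X m = a\<^sub>0 \<and> Y m = a\<^sub>0)"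
      unfolding measure_pair_position[OF V(2,2)] by simp
    moreover have "0 < ?P a\<^sub>0 a\<^sub>0" using that(3) by (simp add: zero_less_measure_iff)
    ultimately show ?thesis using pos V by blast
  qed
  show ?thesis
  proof (intro conjI ballI impI)
    show "?P a b \<in> {0, 1}" if "a \<in> V" "b \<in> V" for a b using zero_one[OF that] .
    show "?P a b = 1" if "a\<^sub>0 \<in> V" "b\<^sub>0 \<in> V" "0 < ?P a\<^sub>0 b\<^sub>0" "a \<in> V" "b \<in> V"
      "\<exists>m. 0 < \<P>((X, Y) in indep_walks V E a b. X m = a\<^sub>0 \<and> Y m = b\<^sub>0)" for a\<^sub>0 b\<^sub>0 a b
      using pos that by blast
    show "(\<forall>a\<in>V. ?P a a = 0) \<or> (\<forall>a\<in>V. ?P a a = 1)" using diag by blast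
  qed
qed

end
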